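(* Let $f:\mathbb{R}^n\to\mathbb{R}$ be twice continuously differentiable, with $L_g$-Lipschitz continuous gradient and $L_H$-Lipschitz continuous Hessian on $\mathbb{R}^n$, and bounded below by a scalar $\bar f\in\mathbb{R}$. Let the Two-Step Method (defined in the context) be run with Hessian approximations, negative curvature directions and gradient approximations satisfying the deterministic inexactness conditions (a), (b), (c) stated in the context, with parameters $\gamma\in(0,1]$, $\delta\in(0,\infty)$, $\theta\in[0,1)$, $\gamma_H\in[0,\gamma)$, $\gamma_\lambda\in[0,1)$, $\hat\theta\in[0,1)$, and with constant step sizes $\alpha>0$, $\beta>0$ satisfying $$\alpha \le \frac{(1-\hat\theta)^2}{L_g(1+\hat\theta)},\qquad \beta\le \frac{\gamma-\gamma_H}{\delta L_H}.$$ Consider any scalars $\epsilon_g>0$ and $\epsilon_H>0$. Then the cardinality of the index set $\mathcal{G}(\epsilon_g):=\{k\in\mathbb{N}:\|\nabla f(x_k)\|_2>\epsilon_g\}$ is at most $\mathcal{O}(\epsilon_g^{-2})$, and the cardinality of the index set $\mathcal{H}(\epsilon_H):=\{k\in\mathbb{N}:|\lambda_{\min,k}^-|>\epsilon_H\}$ is at most $\mathcal{O}(\epsilon_H^{-3})$. Hence, the number of iterations and derivative (i.e., gradient and Hessian) evaluations required until an iteration $k\in\mathbb{N}$ is reached with $\|\nabla f(x_k)\|_2\le\epsilon_g$ and $\lambda_{\min}(\nabla^2 f(x_k))\ge-\epsilon_H$ is at most $\mathcal{O}(\max\{\epsilon_g^{-2},\epsilon_H^{-3}\})$.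
   Context: $\lambda_{\min}(A)$ denotes the left-most (smallest) eigenvalue of a symmetric matrix $A$. $\mathbb{N}=\{0,1,2,\dots\}$. The $\mathcal{O}(\cdot)$ notation refers to small tolerances $\epsilon_g,\epsilon_H$, with constants independent of $\epsilon_g,\epsilon_H$; index sets range over the iterates generated by the method. Two-Step Method. Given $x_0\in\mathbb{R}^n$, $\alpha>0$, $\beta>0$, for $k=0,1,2,\dots$: 1. Compute a (symmetric) Hessian approximation $H_k\in\mathbb{R}^{n\times n}$ of $\nabla^2 f(x_k)$, with left-most eigenvalue $\lambda_k$, such that condition (b) holds. If $\lambda_k\ge 0$ set $p_k=0$; otherwise compute $q_k$ and set $p_k$ using condition (a). 2. Set $\hat x_k=x_k+\beta p_k$. 3. Compute a gradient approximation $\hat g_k\in\mathbb{R}^n$ at $\hat x_k$ satisfying condition (c), and set $d_k=-\hat g_k$ (so $d_k=0$ if $\hat g_k=0$). 4. If $p_k=d_k=0$, terminate and return $x_k$. 5. Set $x_{k+1}=\hat x_k+\alpha d_k=x_k+\beta p_k+\alpha d_k$. Conditions, required for every iteration $k$. Write $\lambda_k^-:=\min\{\lambda_k,0\}$ and $\lambda_{\min,k}^-:=\min\{\lambda_{\min}(\nabla^2 f(x_k)),0\}$. (a) If $\lambda_k\ge0$, then $p_k=0$. Otherwise $p_k=q_k$ if $q_k^{\mathsf T}g_k\le 0$ and $p_k=-q_k$ otherwise, where $q_k\in\mathbb{R}^n$ satisfies $q_k^{\mathsf T}H_kq_k\le\gamma\lambda_k\|q_k\|_2^2<0$ and $\|q_k\|_2=\delta|\lambda_k|$,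 and the gradient approximation $g_k\in\mathbb{R}^n$ satisfies $|(g_k-\nabla f(x_k))^{\mathsf T}q_k|\le\theta\,|g_k^{\mathsf T}q_k|$. (b) $\|(H_k-\nabla^2 f(x_k))p_k\|_2\le\gamma_H|\lambda_k^-|\,\|p_k\|_2$ and $|\lambda_k^--\lambda_{\min,k}^-|\le\gamma_\lambda|\lambda_k^-|$. (c) $\|\nabla f(\hat x_k)-\hat g_k\|_2\le\hat\theta\|\hat g_k\|_2$. *)

theory Defs
  imports "HOL-Analysis.Analysis"
begin

definition eigenvalues :: "real^'n^'n \<Rightarrow> real set" where
  "eigenvalues A = {\<mu>. \<exists>v. v \<noteq> 0 \<and> A *v v = \<mu> *\<^sub>R v}"

text \<open>Only meaningful for symmetric matrices, whose set of real eigenvalues is finite and nonempty.\<close>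
definition lambda_min :: "real^'n^'n \<Rightarrow> real" where
  "lambda_min A = Min (eigenvalues A)"

definition neg_part :: "real \<Rightarrow> real" where
  "neg_part a = min a 0"

text \<open>The norm on matrices that is induced by the Euclidean norm. The library's \<open>norm\<close> on
  \<open>real^'n^'n\<close> is the Frobenius norm, which would give another Lipschitz constant.\<close>
definition spectral_norm :: "real^'n^'n \<Rightarrow> real" where
  "spectral_norm A = onorm ((*v) A)"

definition twice_cont_diff ::
  "(real^'n \<Rightarrow> real) \<Rightarrow> (real^'n \<Rightarrow> real^'n) \<Rightarrow> (real^'n \<Rightarrow> real^'n^'n) \<Rightarrow> bool" where
  "twice_cont_diff f grad hess \<longleftrightarrow>
     (\<forall>x. GDERIV f x :> grad x) \<and>
     (\<forall>x. (grad has_derivative ((*v) (hess x))) (at x)) \<and>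
     continuous_on UNIV hess"

definition cond_a ::
  "real \<Rightarrow> real \<Rightarrow> real \<Rightarrow> real^'n \<Rightarrow> real^'n^'n \<Rightarrow> real^'n \<Rightarrow> real^'n \<Rightarrow> real^'n \<Rightarrow> bool" where
  "cond_a \<gamma> \<delta> \<theta> gradx H g q p \<longleftrightarrow>
     (if lambda_min H \<ge> 0 then p = 0
      else q \<bullet> (H *v q) \<le> \<gamma> * lambda_min H * (norm q)\<^sup>2 \<and>
           \<gamma> * lambda_min H * (norm q)\<^sup>2 < 0 \<and>
           norm q = \<delta> * \<bar>lambda_min H\<bar> \<and>
           \<bar>(g - gradx) \<bullet> q\<bar> \<le> \<theta> * \<bar>g \<bullet> q\<bar> \<and>
           p = (if q \<bullet> g \<le> 0 then q else - q))"

definition cond_b ::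
  "real \<Rightarrow> real \<Rightarrow> real^'n^'n \<Rightarrow> real^'n^'n \<Rightarrow> real^'n \<Rightarrow> bool" where
  "cond_b \<gamma>\<^sub>H \<gamma>\<^sub>l hessx H p \<longleftrightarrow>
     norm ((H - hessx) *v p) \<le> \<gamma>\<^sub>H * \<bar>neg_part (lambda_min H)\<bar> * norm p \<and>
     \<bar>neg_part (lambda_min H) - neg_part (lambda_min hessx)\<bar>
       \<le> \<gamma>\<^sub>l * \<bar>neg_part (lambda_min H)\<bar>"

definition cond_c :: "real \<Rightarrow> real^'n \<Rightarrow> real^'n \<Rightarrow> bool" where
  "cond_c \<theta>h gradxh gh \<longleftrightarrow> norm (gradxh - gh) \<le> \<theta>h * norm gh"

text \<open>The data of a run: \<open>xh\<close> and \<open>gh\<close> are the hatted quantities. If the method terminates,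
  the entries after the last iteration are irrelevant.\<close>
record 'n run =
  x :: "nat \<Rightarrow> real^'n"
  H :: "nat \<Rightarrow> real^'n^'n"
  g :: "nat \<Rightarrow> real^'n"
  q :: "nat \<Rightarrow> real^'n"
  p :: "nat \<Rightarrow> real^'n"
  xh :: "nat \<Rightarrow> real^'n"
  gh :: "nat \<Rightarrow> real^'n"
  d :: "nat \<Rightarrow> real^'n"

definition terminates_at :: "'n::finite run \<Rightarrow> nat \<Rightarrow> bool" where
  "terminates_at R k \<longleftrightarrow> p R k = 0 \<and> d R k = 0"

text \<open>Iteration \<open>k\<close> is carried out, that is, \<open>x\<^sub>k\<close> is one of the iterates generated.\<close>
definition reached :: "'n::finite run \<Rightarrow> nat \<Rightarrow> bool" where
  "reached R k \<longleftrightarrow> (\<forall>j<k. \<not> terminates_at R j)"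

definition two_step_run ::
  "(real^'n \<Rightarrow> real^'n) \<Rightarrow> (real^'n \<Rightarrow> real^'n^'n) \<Rightarrow> real \<Rightarrow> real \<Rightarrow> real \<Rightarrow> real \<Rightarrow> real \<Rightarrow> real \<Rightarrow>
   real \<Rightarrow> real \<Rightarrow> real^'n \<Rightarrow> 'n::finite run \<Rightarrow> bool" where
  "two_step_run grad hess \<gamma> \<delta> \<theta> \<gamma>\<^sub>H \<gamma>\<^sub>l \<theta>h \<alpha> \<beta> x0 R \<longleftrightarrow>
     x R 0 = x0 \<and>
     (\<forall>k. reached R k \<longrightarrow>
        transpose (H R k) = H R k \<and>
        cond_a \<gamma> \<delta> \<theta> (grad (x R k)) (H R k) (g R k) (q R k) (p R k) \<and>
        cond_b \<gamma>\<^sub>H \<gamma>\<^sub>l (hess (x R k)) (H R k) (p R k) \<and>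
        xh R k = x R k + \<beta> *\<^sub>R p R k \<and>
        cond_c \<theta>h (grad (xh R k)) (gh R k) \<and>
        d R k = - gh R k \<and>
        (\<not> terminates_at R k \<longrightarrow> x R (Suc k) = xh R k + \<alpha> *\<^sub>R d R k))"

definition G_set :: "(real^'n \<Rightarrow> real^'n) \<Rightarrow> 'n::finite run \<Rightarrow> real \<Rightarrow> nat set" where
  "G_set grad R \<epsilon>g = {k. reached R k \<and> norm (grad (x R k)) > \<epsilon>g}"

definition H_set :: "(real^'n \<Rightarrow> real^'n^'n) \<Rightarrow> 'n::finite run \<Rightarrow> real \<Rightarrow> nat set" where
  "H_set hess R \<epsilon>H = {k. reached R k \<and> \<bar>neg_part (lambda_min (hess (x R k)))\<bar> > \<epsilon>H}"

text \<open>Gradient and Hessian evaluations in the iterations \<open>0, \<dots>, N - 1\<close>: in each of them one of \<open>H\<close>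
  and one of \<open>gh\<close>, and one of \<open>g\<close> if a direction of negative curvature is computed.\<close>
definition derivative_evals :: "'n::finite run \<Rightarrow> nat \<Rightarrow> nat" where
  "derivative_evals R N = (\<Sum>j<N. 2 + (if lambda_min (H R j) < 0 then 1 else 0))"

hide_const (open) x H g q p xh gh d

end

theory Submission
  imports Defs
begin

text \<open>
  Every iteration decreases \<open>f\<close> by an amount that controls both optimality measures at its starting
  point \<open>x\<^sub>k\<close>: up to constant factors, \<open>f x\<^sub>k - f x\<^sub>k\<^sub>+\<^sub>1\<close> is at least \<open>(norm (grad x\<^sub>k))\<^sup>2\<close> and at least
  the third power of the negative part of the least eigenvalue of \<open>hess x\<^sub>k\<close> (lemma
  \<open>two_step_progress\<close>). As \<open>f\<close> is bounded below, the decreases sum to at most \<open>f x0 - fbar\<close>, so at most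
  \<open>O(\<epsilon>g^-2)\<close> iterations have a gradient larger than \<open>\<epsilon>g\<close>, and at most \<open>O(\<epsilon>H^-3)\<close> a curvature below
  \<open>-\<epsilon>H\<close>. The first iterate in neither class comes after at most that many iterations, each of which
  evaluates at most three derivatives.

  Let \<open>\<nu>\<close> be the absolute value of the negative part of the least eigenvalue of the approximate
  Hessian. The step along \<open>p\<close> has length of order \<open>\<nu>\<close> and, by the cubic Taylor bound, decreases \<open>f\<close> by a
  multiple of \<open>\<nu>\<^sup>3\<close> (\<open>curvature_step_decrease\<close>). The gradient step then decreases \<open>f\<close> by a
  multiple of the squared gradient at the intermediate point (\<open>gradient_step_decrease\<close>). Since \<open>\<nu>\<close>
  is comparable with the true negative curvature, the second bound follows at once.

  For the first bound, the gradient at \<open>x\<^sub>k\<close> must be compared with the one at the intermediate point. The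
  Lipschitz constant alone bounds their difference by a multiple of \<open>\<nu>\<close>, which would lead
  to \<open>O(\<epsilon>g^-3)\<close>. However, the Hessian is bounded above by \<open>Lg\<close> and below by a multiple of \<open>-\<nu>\<close>, and
  the curvature along \<open>p\<close> is nonpositive; a Cauchy--Schwarz argument for the shifted, semidefinite
  Hessian (\<open>norm_nonpos_curvature_image_le\<close>) then shows that \<open>hess x\<^sub>k *v p\<close> has length at most of
  order \<open>\<nu>\<close> to the power 3/2. So the squared change of the gradient is at most of order \<open>\<nu>\<^sup>3\<close>
  (\<open>gradient_change_along_direction\<close>), and the decrease from the step along \<open>p\<close> pays for it.

  The argument needs that \<open>lambda_min\<close> is the minimum of the Rayleigh quotient and that the Hessian
  is symmetric; the latter is proved with second differences.
\<close>

section \<open>Quadratic forms and least eigenvalues of symmetric matrices\<close>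

lemma symmetric_matrix_inner:
  fixes A :: "real^'n^'n"
  assumes "transpose A = A"
  shows "u \<bullet> (A *v w) = (A *v u) \<bullet> w"
  by (metis assms dot_lmul_matrix transpose_matrix_vector)

text \<open>
  The Cauchy--Schwarz inequality for the semidefinite form of \<open>B\<close>, applied to \<open>v\<close> and \<open>B *v v\<close>: the
  form is nonnegative at \<open>v - (B *v v) / M\<close>, the point reached from \<open>v\<close> by a descent step. The lemma
  turns a bound on curvature along \<open>v\<close> into a bound on the whole vector \<open>B *v v\<close>.
\<close>
lemma norm_psd_image_le:
  fixes B :: "real^'n^'n"
  assumes sym: "transpose B = B" and psd: "\<And>v. 0 \<le> v \<bullet> (B *v v)"
    and "M > 0" and bound: "\<And>v. norm (B *v v) \<le> M * norm v"
  shows "(norm (B *v v))\<^sup>2 \<le> M * (v \<bullet> (B *v v))"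
proof -
  define w where "w = B *v v"
  have vw: "v \<bullet> (B *v w) = (norm w)\<^sup>2"
    by (simp add: symmetric_matrix_inner[OF sym] w_def power2_norm_eq_inner)
  have ww: "w \<bullet> (B *v w) \<le> M * (norm w)\<^sup>2"
    using norm_cauchy_schwarz[of w "B *v w"] mult_left_mono[OF bound[of w], of "norm w"]
    by (simp add: power2_eq_square algebra_simps)
  have "0 \<le> (v - (1/M) *\<^sub>R w) \<bullet> (B *v (v - (1/M) *\<^sub>R w))"
    by (rule psd)
  also have "\<dots> = v \<bullet> w - 2 / M * (norm w)\<^sup>2 + (1/M)\<^sup>2 * (w \<bullet> (B *v w))"
    using \<open>M > 0\<close>
    by (simp add: matrix_vector_mult_diff_distrib matrix_vector_mult_scaleR inner_diff_left
        inner_diff_right w_def[symmetric] vw power2_norm_eq_inner[symmetric] power2_eq_square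
        field_simps)
  also have "\<dots> \<le> v \<bullet> w - 2 / M * (norm w)\<^sup>2 + (1/M)\<^sup>2 * (M * (norm w)\<^sup>2)"
    by (intro add_left_mono mult_left_mono ww) simp
  also have "\<dots> = v \<bullet> w - (norm w)\<^sup>2 / M"
    using \<open>M > 0\<close> by (simp add: power2_eq_square field_simps)
  finally show ?thesis
    using \<open>M > 0\<close> by (simp add: w_def field_simps)
qed

text \<open>
  Eigenvectors of a symmetric matrix for distinct eigenvalues are orthogonal, and an orthogonal family
  in a Euclidean space is finite.
\<close>
lemma finite_eigenvalues:
  fixes A :: "real^'n^'n"
  assumes sym: "transpose A = A"
  shows "finite (eigenvalues A)"
proof -
  define ev where "ev \<mu> = (SOME v. v \<noteq> 0 \<and> A *v v = \<mu> *\<^sub>R v)" for \<mu>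
  have ev: "ev \<mu> \<noteq> 0 \<and> A *v ev \<mu> = \<mu> *\<^sub>R ev \<mu>" if "\<mu> \<in> eigenvalues A" for \<mu>
    using that unfolding ev_def eigenvalues_def mem_Collect_eq by (rule someI_ex)
  have orth: "ev \<mu> \<bullet> ev \<nu> = 0" if "\<mu> \<in> eigenvalues A" "\<nu> \<in> eigenvalues A" "\<mu> \<noteq> \<nu>" for \<mu> \<nu>
    using symmetric_matrix_inner[OF sym, of "ev \<mu>" "ev \<nu>"] ev[OF that(1)] ev[OF that(2)] that(3)
    by simp
  have "inj_on ev (eigenvalues A)"
    using orth ev by (metis inj_onI inner_eq_zero_iff)
  moreover have "finite (ev ` eigenvalues A)"
    by (rule pairwise_orthogonal_imp_finite) (use orth in \<open>auto simp: pairwise_def orthogonal_def\<close>)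
  ultimately show ?thesis
    by (simp add: finite_image_iff)
qed

text \<open>
  A minimizer \<open>u\<close> of the quadratic form on the unit sphere, with minimum \<open>m\<close>, is an eigenvector: the form
  of \<open>A - m I\<close> is semidefinite and vanishes at \<open>u\<close>, so \<open>norm_psd_image_le\<close> gives \<open>A *v u = m *\<^sub>R u\<close>.
\<close>
lemma rayleigh_minimum_eigenvalue:
  fixes A :: "real^'n^'n"
  assumes sym: "transpose A = A"
  obtains m where "m \<in> eigenvalues A" "\<And>v. m * (norm v)\<^sup>2 \<le> v \<bullet> (A *v v)"
proof -
  have "sphere (0::real^'n) 1 \<noteq> {}"
    by simp
  moreover have "continuous_on (sphere 0 1) (\<lambda>v. v \<bullet> (A *v v))"
    by (intro continuous_intros linear_continuous_on matrix_vector_mul_bounded_linear)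
  ultimately obtain u where u: "u \<in> sphere 0 1"
    and min: "\<And>v. v \<in> sphere 0 1 \<Longrightarrow> u \<bullet> (A *v u) \<le> v \<bullet> (A *v v)"
    using continuous_attains_inf[OF compact_sphere, of 0 1 "\<lambda>v. v \<bullet> (A *v v)"] by blast
  define m where "m = u \<bullet> (A *v u)"
  have le: "m * (norm v)\<^sup>2 \<le> v \<bullet> (A *v v)" for v
  proof (cases "v = 0")
    case False
    then have "m \<le> ((1 / norm v) *\<^sub>R v) \<bullet> (A *v ((1 / norm v) *\<^sub>R v))"
      unfolding m_def by (intro min) simp
    also have "\<dots> = (v \<bullet> (A *v v)) / (norm v)\<^sup>2"
      by (simp add: matrix_vector_mult_scaleR power2_eq_square)
    finally show ?thesis
      using False by (simp add: field_simps)
  qed simp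
  define B where "B = A - m *\<^sub>R mat 1"
  have Bv: "B *v v = A *v v - m *\<^sub>R v" for v
    by (simp add: B_def matrix_vector_mult_diff_rdistrib scaleR_matrix_vector_assoc[symmetric])
  have "(norm (B *v u))\<^sup>2 \<le> (onorm ((*v) B) + 1) * (u \<bullet> (B *v u))"
  proof (rule norm_psd_image_le)
    show "transpose B = B"
      using sym by (simp add: B_def transpose_def vec_eq_iff mat_def)
    show "0 \<le> v \<bullet> (B *v v)" for v
      using le[of v] by (simp add: Bv inner_diff_right power2_norm_eq_inner)
    show "0 < onorm ((*v) B) + 1"
      using onorm_pos_le[OF matrix_vector_mul_bounded_linear[of B]] by linarith
    show "norm (B *v v) \<le> (onorm ((*v) B) + 1) * norm v" for v
      using onorm[OF matrix_vector_mul_bounded_linear[of B], of v]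
      by (simp add: distrib_right add_increasing2)
  qed
  also have "u \<bullet> (B *v u) = 0"
    using u by (simp add: Bv inner_diff_right m_def power2_norm_eq_inner[symmetric])
  finally have "A *v u = m *\<^sub>R u"
    by (simp add: Bv)
  then have "m \<in> eigenvalues A"
    using u by (auto simp: eigenvalues_def intro!: exI[of _ u])
  with le that show thesis by blast
qed

lemma
  fixes A :: "real^'n^'n"
  assumes sym: "transpose A = A"
  shows lambda_min_in_eigenvalues: "lambda_min A \<in> eigenvalues A"
    and lambda_min_le_rayleigh: "lambda_min A * (norm v)\<^sup>2 \<le> v \<bullet> (A *v v)"
proof -
  obtain m where m: "m \<in> eigenvalues A" and le: "\<And>v. m * (norm v)\<^sup>2 \<le> v \<bullet> (A *v v)"
    using rayleigh_minimum_eigenvalue[OF sym] by metis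
  show "lambda_min A \<in> eigenvalues A"
    unfolding lambda_min_def using m by (intro Min_in finite_eigenvalues sym) auto
  have "lambda_min A \<le> m"
    unfolding lambda_min_def using m by (intro Min_le finite_eigenvalues sym)
  then have "lambda_min A * (norm v)\<^sup>2 \<le> m * (norm v)\<^sup>2"
    by (intro mult_right_mono) auto
  also note le
  finally show "lambda_min A * (norm v)\<^sup>2 \<le> v \<bullet> (A *v v)" .
qed

lemma abs_eigenvalue_le:
  fixes A :: "real^'n^'n"
  assumes "\<mu> \<in> eigenvalues A" and "\<And>v. norm (A *v v) \<le> L * norm v"
  shows "\<bar>\<mu>\<bar> \<le> L"
proof -
  obtain v where "v \<noteq> 0" "A *v v = \<mu> *\<^sub>R v"
    using assms(1) by (auto simp: eigenvalues_def)
  with assms(2)[of v] show ?thesis by simp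
qed

lemma norm_add_squared_le:
  fixes u v :: "'a::real_normed_vector"
  shows "(norm (u + v))\<^sup>2 \<le> 2 * (norm u)\<^sup>2 + 2 * (norm v)\<^sup>2"
proof -
  have "(norm (u + v))\<^sup>2 \<le> (norm u + norm v)\<^sup>2"
    by (intro power_mono norm_triangle_ineq) auto
  also have "\<dots> \<le> 2 * (norm u)\<^sup>2 + 2 * (norm v)\<^sup>2"
    using sum_squares_bound[of "norm u" "norm v"] by (simp add: power2_sum)
  finally show ?thesis .
qed

text \<open>
  Here lies the exponent 3/2. If the spectrum of \<open>A\<close> lies in \<open>[-\<mu>, L]\<close> and the curvature along \<open>v\<close> is
  nonpositive, the negative part of the spectrum must compensate any positive curvature, so \<open>v\<close> can have
  only small components in directions of large curvature. Hence \<open>norm (A *v v)\<close> is at most of order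
  \<open>sqrt ((L + \<mu>) * \<mu>) * norm v\<close>, although \<open>v\<close> need not be close to an eigenvector. Formally,
  \<open>norm_psd_image_le\<close> is applied to the semidefinite matrix \<open>A + \<mu> I\<close>.
\<close>
lemma norm_nonpos_curvature_image_le:
  fixes A :: "real^'n^'n"
  assumes sym: "transpose A = A" and "L > 0" and bound: "\<And>v. norm (A *v v) \<le> L * norm v"
    and "0 \<le> \<mu>" "- \<mu> \<le> lambda_min A" and neg: "v \<bullet> (A *v v) \<le> 0"
  shows "(norm (A *v v))\<^sup>2 \<le> 2 * (L + 2 * \<mu>) * \<mu> * (norm v)\<^sup>2"
proof -
  define B where "B = A + \<mu> *\<^sub>R mat 1"
  have Bv: "B *v w = A *v w + \<mu> *\<^sub>R w" for w
    by (simp add: B_def matrix_vector_mult_add_rdistrib scaleR_matrix_vector_assoc[symmetric])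
  have "(norm (B *v v))\<^sup>2 \<le> (L + \<mu>) * (v \<bullet> (B *v v))"
  proof (rule norm_psd_image_le)
    show "transpose B = B"
      using sym by (simp add: B_def transpose_def vec_eq_iff mat_def)
    show "0 \<le> w \<bullet> (B *v w)" for w
    proof -
      have "- \<mu> * (norm w)\<^sup>2 \<le> lambda_min A * (norm w)\<^sup>2"
        using assms by (intro mult_right_mono) auto
      also note lambda_min_le_rayleigh[OF sym, of w]
      finally show ?thesis
        by (simp add: Bv inner_add_right power2_norm_eq_inner)
    qed
    show "0 < L + \<mu>" using assms by linarith
    show "norm (B *v w) \<le> (L + \<mu>) * norm w" for w
      using norm_triangle_ineq[of "A *v w" "\<mu> *\<^sub>R w"] bound[of w] \<open>0 \<le> \<mu>\<close>
      by (simp add: Bv algebra_simps)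
  qed
  also have "\<dots> \<le> (L + \<mu>) * (\<mu> * (norm v)\<^sup>2)"
    using neg assms by (intro mult_left_mono) (auto simp: Bv inner_add_right power2_norm_eq_inner)
  finally have B: "(norm (B *v v))\<^sup>2 \<le> (L + \<mu>) * (\<mu> * (norm v)\<^sup>2)" .
  have "(norm (A *v v))\<^sup>2 = (norm (B *v v + - (\<mu> *\<^sub>R v)))\<^sup>2"
    by (simp add: Bv)
  also have "\<dots> \<le> 2 * (norm (B *v v))\<^sup>2 + 2 * (\<mu> * norm v)\<^sup>2"
    using norm_add_squared_le[of "B *v v" "- (\<mu> *\<^sub>R v)"] by (simp add: power_mult_distrib)
  also have "\<dots> \<le> 2 * ((L + \<mu>) * (\<mu> * (norm v)\<^sup>2)) + 2 * (\<mu> * norm v)\<^sup>2"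
    using B by simp
  finally show ?thesis
    by (simp add: power2_eq_square algebra_simps)
qed

section \<open>Taylor estimates for a function with Lipschitz gradient and Hessian\<close>

locale smooth_objective =
  fixes f :: "real^'n \<Rightarrow> real"
    and grad :: "real^'n \<Rightarrow> real^'n"
    and hess :: "real^'n \<Rightarrow> real^'n^'n"
    and Lg LH :: real
  assumes gradient: "GDERIV f y :> grad y"
    and hessian: "(grad has_derivative ((*v) (hess y))) (at y)"
    and Lg_pos: "0 < Lg"
    and grad_Lipschitz: "norm (grad y - grad z) \<le> Lg * norm (y - z)"
    and LH_pos: "0 < LH"
    and hess_Lipschitz: "norm ((hess y - hess z) *v v) \<le> LH * norm (y - z) * norm v"
begin

lemma DERIV_along_line:
  "((\<lambda>t. f (y + t *\<^sub>R s)) has_real_derivative grad (y + t *\<^sub>R s) \<bullet> s) (at t)"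
proof -
  have "((\<lambda>t. f (y + t *\<^sub>R s)) has_derivative (\<lambda>h. (h *\<^sub>R s) \<bullet> grad (y + t *\<^sub>R s))) (at t)"
    by (rule has_derivative_compose[of "\<lambda>t. y + t *\<^sub>R s" "\<lambda>h. h *\<^sub>R s" t UNIV f])
       (use gradient in \<open>auto simp: gderiv_def intro!: derivative_eq_intros\<close>)
  then show ?thesis
    by (simp add: has_field_derivative_def inner_commute mult_commute_abs)
qed

lemma DERIV_gradient_along_line:
  "((\<lambda>t. grad (y + t *\<^sub>R s) \<bullet> v) has_real_derivative v \<bullet> (hess (y + t *\<^sub>R s) *v s)) (at t)"
proof -
  have "((\<lambda>t. grad (y + t *\<^sub>R s)) has_derivative (\<lambda>h. hess (y + t *\<^sub>R s) *v (h *\<^sub>R s))) (at t)"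
    by (rule has_derivative_compose[of "\<lambda>t. y + t *\<^sub>R s" "\<lambda>h. h *\<^sub>R s" t UNIV grad])
       (use hessian in \<open>auto intro!: derivative_eq_intros\<close>)
  from has_derivative_inner_left[OF this, of v] show ?thesis
    by (simp add: has_field_derivative_def inner_commute matrix_vector_mult_scaleR
        mult.commute[of _ "v \<bullet> (hess (y + t *\<^sub>R s) *v s)"])
qed

text \<open>
  The Hessian is frozen at a third point \<open>z\<close>, since the second difference below compares increments of
  the gradient at shifted points with the Hessian at one fixed point.
\<close>
lemma gradient_linearization:
  assumes "norm (y - z) \<le> r" "norm (y + s - z) \<le> r"
  shows "norm (grad (y + s) - grad y - hess z *v s) \<le> norm s * (LH * r)"
proof -
  have "0 \<le> r" using assms(1) norm_ge_zero order_trans by blast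
  have "norm (grad (y + s) - grad y - hess z *v ((y + s) - y)) \<le> norm ((y + s) - y) * (LH * r)"
  proof (rule differentiable_bound_linearization[where S = "cball z r" and f' = "\<lambda>w. (*v) (hess w)"])
    have "y \<in> cball z r" "y + s \<in> cball z r"
      using assms by (auto simp: dist_norm norm_minus_commute)
    then show "y + t *\<^sub>R (y + s - y) \<in> cball z r" if "t \<in> {0..1}" for t
      using that convexD_alt[OF convex_cball, of y z r "y + s" t]
      by (simp add: algebra_simps)
    show "(grad has_derivative (*v) (hess w)) (at w within cball z r)" for w
      using hessian by (rule has_derivative_at_withinI)
    show "onorm ((*v) (hess w) - (*v) (hess z)) \<le> LH * r" if "w \<in> cball z r" for w
    proof (rule onorm_le)
      fix v :: "real^'n"
      have "norm ((hess w - hess z) *v v) \<le> LH * norm (w - z) * norm v"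
        by (rule hess_Lipschitz)
      also have "\<dots> \<le> LH * r * norm v"
        using that LH_pos by (intro mult_right_mono mult_left_mono) (auto simp: dist_norm norm_minus_commute)
      finally show "norm (((*v) (hess w) - (*v) (hess z)) v) \<le> LH * r * norm v"
        by (simp add: matrix_vector_mult_diff_rdistrib)
    qed
    show "z \<in> cball z r" using \<open>0 \<le> r\<close> by simp
  qed
  then show ?thesis by simp
qed

text \<open>
  The mean value theorem in direction \<open>v\<close> and linearization of the gradient in direction \<open>u\<close> identify the
  leading term of the second difference. The second difference itself is symmetric in \<open>u\<close> and \<open>v\<close>, and
  dividing by \<open>t\<^sup>2\<close> and letting \<open>t\<close> tend to 0 makes the leading term symmetric as well.
\<close>
lemma second_difference:
  assumes "0 < t"
  shows "\<bar>f (y + t *\<^sub>R u + t *\<^sub>R v) - f (y + t *\<^sub>R u) - f (y + t *\<^sub>R v) + f y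
           - t\<^sup>2 * (v \<bullet> (hess y *v u))\<bar> \<le> t ^ 3 * (LH * norm u * norm v * (norm u + norm v))"
proof -
  define \<phi> where "\<phi> r = f (y + t *\<^sub>R u + r *\<^sub>R v) - f (y + r *\<^sub>R v)" for r
  have d: "(\<phi> has_real_derivative (grad (y + t *\<^sub>R u + r *\<^sub>R v) - grad (y + r *\<^sub>R v)) \<bullet> v) (at r)" for r
    unfolding \<phi>_def inner_diff_left by (intro DERIV_diff DERIV_along_line)
  obtain r where r: "0 < r" "r < t"
    and mvt: "\<phi> t - \<phi> 0 = (t - 0) * ((grad (y + t *\<^sub>R u + r *\<^sub>R v) - grad (y + r *\<^sub>R v)) \<bullet> v)"
    using MVT2[OF \<open>0 < t\<close>, of \<phi>, OF d] by blast
  define e where "e = grad ((y + r *\<^sub>R v) + t *\<^sub>R u) - grad (y + r *\<^sub>R v) - hess y *v (t *\<^sub>R u)"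
  have "norm e \<le> norm (t *\<^sub>R u) * (LH * (t * (norm u + norm v)))"
    unfolding e_def
  proof (rule gradient_linearization)
    have *: "r * norm v \<le> t * norm v" "0 \<le> t * norm u"
      using r by (auto intro: mult_right_mono)
    then show "norm (y + r *\<^sub>R v - y) \<le> t * (norm u + norm v)"
      using r by (simp add: distrib_left add_increasing)
    show "norm (y + r *\<^sub>R v + t *\<^sub>R u - y) \<le> t * (norm u + norm v)"
      using norm_triangle_ineq[of "r *\<^sub>R v" "t *\<^sub>R u"] r * by (simp add: distrib_left)
  qed
  then have "\<bar>e \<bullet> v\<bar> \<le> (norm (t *\<^sub>R u) * (LH * (t * (norm u + norm v)))) * norm v"
    by (meson Cauchy_Schwarz_ineq2 mult_right_mono norm_ge_zero order_trans)
  then have "t * \<bar>e \<bullet> v\<bar> \<le> t * ((norm (t *\<^sub>R u) * (LH * (t * (norm u + norm v)))) * norm v)"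
    using assms by (intro mult_left_mono) auto
  also have "\<dots> = t ^ 3 * (LH * norm u * norm v * (norm u + norm v))"
    using assms by (simp add: power3_eq_cube)
  also have "t * \<bar>e \<bullet> v\<bar> = \<bar>t * (e \<bullet> v)\<bar>"
    using assms by (simp add: abs_mult)
  also have "t * (e \<bullet> v) = \<phi> t - \<phi> 0 - t\<^sup>2 * (v \<bullet> (hess y *v u))"
    unfolding mvt e_def
    by (simp add: inner_diff_left matrix_vector_mult_scaleR inner_commute power2_eq_square
        algebra_simps)
  finally show ?thesis
    by (simp add: \<phi>_def algebra_simps)
qed

lemma hess_inner_commute: "v \<bullet> (hess y *v u) = u \<bullet> (hess y *v v)"
proof -
  define a where "a = v \<bullet> (hess y *v u) - u \<bullet> (hess y *v v)"
  define C where "C = 2 * (LH * norm u * norm v * (norm u + norm v))"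
  have "0 \<le> C" using LH_pos by (simp add: C_def)
  have small: "\<bar>a\<bar> \<le> t * C" if "0 < t" for t
  proof -
    have "t\<^sup>2 * \<bar>a\<bar> = \<bar>t\<^sup>2 * (v \<bullet> (hess y *v u)) - t\<^sup>2 * (u \<bullet> (hess y *v v))\<bar>"
      by (simp add: a_def abs_mult right_diff_distrib[symmetric])
    also have "\<dots> \<le> t ^ 3 * C"
      using second_difference[OF that, of y u v] second_difference[OF that, of y v u]
      by (simp add: C_def algebra_simps)
    also have "\<dots> = t\<^sup>2 * (t * C)"
      by (simp add: power3_eq_cube power2_eq_square)
    finally show ?thesis
      using that by simp
  qed
  have "a = 0"
  proof (rule ccontr)
    assume "a \<noteq> 0"
    then have "\<bar>a\<bar> \<le> (\<bar>a\<bar> / (2 * (C + 1))) * C"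
      using \<open>0 \<le> C\<close> by (intro small) auto
    also have "\<dots> \<le> \<bar>a\<bar> / 2"
      using \<open>0 \<le> C\<close> by (simp add: field_simps)
    finally show False using \<open>a \<noteq> 0\<close> by simp
  qed
  then show ?thesis by (simp add: a_def)
qed

lemma hess_symmetric: "transpose (hess y) = hess y"
proof -
  have "transpose (hess y) *v v = hess y *v v" for v
  proof (rule vector_eq_ldot[THEN iffD1], rule allI)
    show "u \<bullet> (transpose (hess y) *v v) = u \<bullet> (hess y *v v)" for u
      using hess_inner_commute[of v y u]
      by (metis dot_lmul_matrix inner_commute transpose_matrix_vector)
  qed
  then show ?thesis by (simp add: matrix_eq)
qed

lemma norm_hess_le: "norm (hess y *v v) \<le> Lg * norm v"
proof (rule field_le_epsilon)
  fix e :: real assume "0 < e"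
  define t where "t = e / (LH * (norm v)\<^sup>2 + 1)"
  have den: "0 < LH * (norm v)\<^sup>2 + 1"
    using LH_pos by (simp add: add_nonneg_pos)
  then have "0 < t" using \<open>0 < e\<close> by (simp add: t_def)
  have "norm (grad (y + t *\<^sub>R v) - grad y - hess y *v (t *\<^sub>R v)) \<le> norm (t *\<^sub>R v) * (LH * norm (t *\<^sub>R v))"
    by (rule gradient_linearization) auto
  moreover have "norm (grad (y + t *\<^sub>R v) - grad y) \<le> Lg * norm (t *\<^sub>R v)"
    using grad_Lipschitz[of "y + t *\<^sub>R v" y] by simp
  ultimately have "norm (hess y *v (t *\<^sub>R v)) \<le> Lg * norm (t *\<^sub>R v) + norm (t *\<^sub>R v) * (LH * norm (t *\<^sub>R v))"
    by (smt (verit) norm_triangle_sub norm_minus_commute)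
  then have "t * norm (hess y *v v) \<le> t * (Lg * norm v + t * (LH * (norm v)\<^sup>2))"
    using \<open>0 < t\<close> by (simp add: matrix_vector_mult_scaleR power2_eq_square algebra_simps)
  then have "norm (hess y *v v) \<le> Lg * norm v + t * (LH * (norm v)\<^sup>2)"
    using \<open>0 < t\<close> by simp
  also have "t * (LH * (norm v)\<^sup>2) \<le> e"
    using den \<open>0 < e\<close> by (simp add: t_def field_simps)
  finally show "norm (hess y *v v) \<le> Lg * norm v + e" by simp
qed

lemma quadratic_upper_bound:
  "f (y + s) \<le> f y + grad y \<bullet> s + Lg / 2 * (norm s)\<^sup>2"
proof -
  define \<psi> where "\<psi> t = f (y + t *\<^sub>R s) - t * (grad y \<bullet> s) - t\<^sup>2 * (Lg / 2 * (norm s)\<^sup>2)" for t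
  have "\<psi> 1 \<le> \<psi> 0"
  proof (rule DERIV_nonpos_imp_nonincreasing[where f = \<psi>])
    fix t :: real assume t: "0 \<le> t"
    have "(\<psi> has_real_derivative grad (y + t *\<^sub>R s) \<bullet> s - grad y \<bullet> s - t * (Lg * (norm s)\<^sup>2)) (at t)"
      unfolding \<psi>_def by (auto intro!: derivative_eq_intros DERIV_along_line)
    moreover have "(grad (y + t *\<^sub>R s) - grad y) \<bullet> s \<le> norm (grad (y + t *\<^sub>R s) - grad y) * norm s"
      by (rule norm_cauchy_schwarz)
    moreover have "norm (grad (y + t *\<^sub>R s) - grad y) * norm s \<le> (Lg * (t * norm s)) * norm s"
      using grad_Lipschitz[of "y + t *\<^sub>R s" y] t by (intro mult_right_mono) auto
    ultimately show "\<exists>D. (\<psi> has_real_derivative D) (at t) \<and> D \<le> 0"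
      by (intro exI[of _ "grad (y + t *\<^sub>R s) \<bullet> s - grad y \<bullet> s - t * (Lg * (norm s)\<^sup>2)"])
         (simp add: inner_diff_left power2_eq_square algebra_simps)
  qed simp
  then show ?thesis by (simp add: \<psi>_def)
qed

text \<open>
  The constant 1/6 matters: with the mean-value form of Taylor's remainder, which only gives 1/2, the
  largest admissible \<open>\<beta>\<close> would no longer guarantee a decrease. It is obtained by comparing \<open>f\<close> with the
  cubic along the segment and integrating the Lipschitz bound for the second derivative twice.
\<close>
lemma cubic_upper_bound:
  "f (y + s) \<le> f y + grad y \<bullet> s + (s \<bullet> (hess y *v s)) / 2 + LH / 6 * norm s ^ 3"
proof -
  define c where "c = s \<bullet> (hess y *v s)"
  define \<psi>1 where "\<psi>1 t = grad (y + t *\<^sub>R s) \<bullet> s - grad y \<bullet> s - t * c - t\<^sup>2 * (LH / 2 * norm s ^ 3)" for t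
  have \<psi>1_nonpos: "\<psi>1 t \<le> 0" if "0 \<le> t" for t
  proof -
    have "\<psi>1 t \<le> \<psi>1 0"
    proof (rule DERIV_nonpos_imp_nonincreasing[OF that, where f = \<psi>1])
      fix r :: real assume r: "0 \<le> r"
      have "(\<psi>1 has_real_derivative s \<bullet> (hess (y + r *\<^sub>R s) *v s) - c - r * (LH * norm s ^ 3)) (at r)"
        unfolding \<psi>1_def by (auto intro!: derivative_eq_intros DERIV_gradient_along_line)
      moreover have "s \<bullet> ((hess (y + r *\<^sub>R s) - hess y) *v s)
          \<le> norm s * norm ((hess (y + r *\<^sub>R s) - hess y) *v s)"
        by (rule norm_cauchy_schwarz)
      moreover have "norm s * norm ((hess (y + r *\<^sub>R s) - hess y) *v s)
          \<le> norm s * (LH * (r * norm s) * norm s)"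
        using hess_Lipschitz[of "y + r *\<^sub>R s" y s] r by (intro mult_left_mono) auto
      ultimately show "\<exists>D. (\<psi>1 has_real_derivative D) (at r) \<and> D \<le> 0"
        by (intro exI[of _ "s \<bullet> (hess (y + r *\<^sub>R s) *v s) - c - r * (LH * norm s ^ 3)"])
           (simp add: c_def matrix_vector_mult_diff_rdistrib inner_diff_right power3_eq_cube
             algebra_simps)
    qed
    then show ?thesis by (simp add: \<psi>1_def)
  qed
  define \<psi> where "\<psi> t = f (y + t *\<^sub>R s) - t * (grad y \<bullet> s) - t\<^sup>2 * (c / 2) - t ^ 3 * (LH / 6 * norm s ^ 3)" for t
  have "\<psi> 1 \<le> \<psi> 0"
  proof (rule DERIV_nonpos_imp_nonincreasing[where f = \<psi>])
    fix t :: real assume "0 \<le> t"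
    have "(\<psi> has_real_derivative \<psi>1 t) (at t)"
      unfolding \<psi>_def \<psi>1_def
      by (auto intro!: derivative_eq_intros DERIV_along_line simp: power2_eq_square)
    with \<psi>1_nonpos[OF \<open>0 \<le> t\<close>] show "\<exists>D. (\<psi> has_real_derivative D) (at t) \<and> D \<le> 0"
      by blast
  qed simp
  then show ?thesis by (simp add: \<psi>_def c_def)
qed

end

section \<open>Progress made by one iteration\<close>

locale two_step_method = smooth_objective f grad hess Lg LH
  for f :: "real^'n \<Rightarrow> real" and grad hess Lg LH +
  fixes fbar \<alpha> \<beta> \<gamma> \<delta> \<theta> \<gamma>H \<gamma>l \<theta>h :: real
  assumes bounded_below: "fbar \<le> f y"
    and \<delta>_pos: "0 < \<delta>"
    and \<theta>_le: "\<theta> \<le> 1"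
    and \<gamma>H_less: "\<gamma>H < \<gamma>"
    and \<gamma>l_nonneg: "0 \<le> \<gamma>l" and \<gamma>l_less: "\<gamma>l < 1"
    and \<theta>h_nonneg: "0 \<le> \<theta>h" and \<theta>h_less: "\<theta>h < 1"
    and \<alpha>_pos: "0 < \<alpha>" and \<alpha>_le: "\<alpha> \<le> (1 - \<theta>h)\<^sup>2 / (Lg * (1 + \<theta>h))"
    and \<beta>_pos: "0 < \<beta>" and \<beta>_le: "\<beta> \<le> (\<gamma> - \<gamma>H) / (\<delta> * LH)"
begin

definition "curv_decrease = \<beta>\<^sup>2 * \<delta>\<^sup>2 * (\<gamma> - \<gamma>H) / 3"
definition "grad_decrease = \<alpha> * (1 - \<theta>h) / (2 * (1 + \<theta>h)\<^sup>2)"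
text \<open>
  An upper bound for \<open>\<bar>neg_part (lambda_min B)\<bar>\<close> over all admissible Hessian approximations \<open>B\<close>. It absorbs
  surplus powers of this quantity, so that the bounds hold for all tolerances and not only small ones.
\<close>
definition "curv_max = Lg / (1 - \<gamma>l)"
definition "grad_change = 2 * LH\<^sup>2 * \<beta> ^ 4 * \<delta> ^ 4 * curv_max + 8 * \<beta>\<^sup>2 * \<delta>\<^sup>2 * (Lg + 4 * curv_max)"

lemma curv_decrease_pos: "0 < curv_decrease"
  using \<beta>_pos \<delta>_pos \<gamma>H_less by (simp add: curv_decrease_def)

lemma grad_decrease_pos: "0 < grad_decrease"
  using \<alpha>_pos \<theta>h_less \<theta>h_nonneg by (simp add: grad_decrease_def)

lemma curv_max_pos: "0 < curv_max"
  using Lg_pos \<gamma>l_less by (simp add: curv_max_def)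

lemma grad_change_nonneg: "0 \<le> grad_change"
  using curv_max_pos Lg_pos by (simp add: grad_change_def)

text \<open>
  The relative error bound gives \<open>grad z \<bullet> gh \<ge> (1 - \<theta>h) * (norm gh)\<^sup>2\<close>, and since \<open>\<alpha> * Lg \<le> 1 - \<theta>h\<close>, the
  quadratic term of the upper bound consumes at most half of the resulting decrease.
\<close>
lemma gradient_step_decrease:
  assumes "cond_c \<theta>h (grad z) gh"
  shows "f (z - \<alpha> *\<^sub>R gh) \<le> f z - grad_decrease * (norm (grad z))\<^sup>2"
proof -
  have c: "norm (grad z - gh) \<le> \<theta>h * norm gh"
    using assms by (simp add: cond_c_def)
  have "(gh - grad z) \<bullet> gh \<le> norm (gh - grad z) * norm gh"
    by (rule norm_cauchy_schwarz)
  also have "\<dots> \<le> (\<theta>h * norm gh) * norm gh"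
    using c by (intro mult_right_mono) (auto simp: norm_minus_commute)
  finally have inner: "(1 - \<theta>h) * (norm gh)\<^sup>2 \<le> grad z \<bullet> gh"
    by (simp add: inner_diff_left power2_norm_eq_inner[symmetric] power2_eq_square algebra_simps)
  have "\<alpha> * Lg \<le> (1 - \<theta>h)\<^sup>2 / (1 + \<theta>h)"
    using mult_right_mono[OF \<alpha>_le, of Lg] Lg_pos \<theta>h_nonneg by simp
  also have "\<dots> \<le> 1 - \<theta>h"
    using \<theta>h_nonneg \<theta>h_less mult_left_le[of \<theta>h \<theta>h]
    by (simp add: field_simps power2_eq_square)
  finally have step: "\<alpha> * Lg \<le> 1 - \<theta>h" .
  have "norm (grad z) \<le> (1 + \<theta>h) * norm gh"
    using c norm_triangle_sub[of "grad z" gh] by (simp add: algebra_simps)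
  then have "(norm (grad z))\<^sup>2 \<le> ((1 + \<theta>h) * norm gh)\<^sup>2"
    by (intro power_mono) auto
  then have "grad_decrease * (norm (grad z))\<^sup>2 \<le> grad_decrease * ((1 + \<theta>h) * norm gh)\<^sup>2"
    using grad_decrease_pos by (intro mult_left_mono) auto
  also have "\<dots> = \<alpha> / 2 * ((1 - \<theta>h) * (norm gh)\<^sup>2)"
    using \<theta>h_nonneg by (simp add: grad_decrease_def power_mult_distrib)
  finally have norms: "grad_decrease * (norm (grad z))\<^sup>2 \<le> \<alpha> / 2 * ((1 - \<theta>h) * (norm gh)\<^sup>2)" .
  have "f (z - \<alpha> *\<^sub>R gh) \<le> f z - \<alpha> * (grad z \<bullet> gh) + \<alpha> / 2 * ((\<alpha> * Lg) * (norm gh)\<^sup>2)"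
    using quadratic_upper_bound[of z "- \<alpha> *\<^sub>R gh"] \<alpha>_pos
    by (simp add: power_mult_distrib power2_eq_square algebra_simps)
  also have "\<dots> \<le> f z - \<alpha> * ((1 - \<theta>h) * (norm gh)\<^sup>2) + \<alpha> / 2 * ((1 - \<theta>h) * (norm gh)\<^sup>2)"
    using inner step \<alpha>_pos by (intro add_mono diff_mono mult_left_mono mult_right_mono) auto
  finally show ?thesis using norms by simp
qed

text \<open>
  The error of \<open>g\<close> along \<open>q\<close> is at most \<open>\<bar>g \<bullet> q\<bar>\<close>, so \<open>grad y \<bullet> q\<close> cannot have the opposite sign: the choice of
  sign made with \<open>g\<close> is right for the true gradient.
\<close>
lemma cond_a_direction:
  assumes "cond_a \<gamma> \<delta> \<theta> (grad y) B g q p"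
  shows "norm p = \<delta> * \<bar>neg_part (lambda_min B)\<bar>"
    and "grad y \<bullet> p \<le> 0"
    and "p \<bullet> (B *v p) \<le> - \<gamma> * \<bar>neg_part (lambda_min B)\<bar> * (norm p)\<^sup>2"
proof -
  show "norm p = \<delta> * \<bar>neg_part (lambda_min B)\<bar>"
    and "p \<bullet> (B *v p) \<le> - \<gamma> * \<bar>neg_part (lambda_min B)\<bar> * (norm p)\<^sup>2"
    using assms
    by (auto simp: cond_a_def neg_part_def vec.neg split: if_splits)
  show "grad y \<bullet> p \<le> 0"
  proof (cases "lambda_min B \<ge> 0")
    case True
    then show ?thesis using assms by (simp add: cond_a_def)
  next
    case False
    then have "\<bar>(g - grad y) \<bullet> q\<bar> \<le> \<theta> * \<bar>g \<bullet> q\<bar>" and p: "p = (if q \<bullet> g \<le> 0 then q else - q)"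
      using assms by (auto simp: cond_a_def)
    moreover have "\<theta> * \<bar>g \<bullet> q\<bar> \<le> \<bar>g \<bullet> q\<bar>"
      using mult_right_mono[OF \<theta>_le, of "\<bar>g \<bullet> q\<bar>"] by simp
    ultimately have "\<bar>(g - grad y) \<bullet> q\<bar> \<le> \<bar>g \<bullet> q\<bar>" by linarith
    then show ?thesis
      by (auto simp: p inner_diff_left inner_commute[of q g])
  qed
qed

lemma curvature_along_direction:
  assumes a: "cond_a \<gamma> \<delta> \<theta> (grad y) B g q p" and b: "cond_b \<gamma>H \<gamma>l (hess y) B p"
  shows "p \<bullet> (hess y *v p) \<le> - (\<gamma> - \<gamma>H) * \<bar>neg_part (lambda_min B)\<bar> * (norm p)\<^sup>2"
proof -
  have "- (p \<bullet> ((B - hess y) *v p)) \<le> norm p * norm ((B - hess y) *v p)"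
    using Cauchy_Schwarz_ineq2[of p "(B - hess y) *v p"] by linarith
  also have "\<dots> \<le> norm p * (\<gamma>H * \<bar>neg_part (lambda_min B)\<bar> * norm p)"
    using b by (intro mult_left_mono) (auto simp: cond_b_def)
  finally show ?thesis
    using cond_a_direction(3)[OF a]
    by (simp add: matrix_vector_mult_diff_rdistrib inner_diff_right power2_eq_square algebra_simps)
qed

text \<open>
  With \<open>\<nu> = \<bar>neg_part (lambda_min B)\<bar>\<close> and \<open>c = (\<gamma> - \<gamma>H) * \<beta>\<^sup>2 * \<delta>\<^sup>2 * \<nu> ^ 3\<close>, the quadratic term of the cubic
  bound is at most \<open>- c / 2\<close>, and the condition on \<open>\<beta>\<close> makes the cubic term at most \<open>c / 6\<close>.
\<close>
lemma curvature_step_decrease: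
  assumes a: "cond_a \<gamma> \<delta> \<theta> (grad y) B g q p" and b: "cond_b \<gamma>H \<gamma>l (hess y) B p"
  shows "f (y + \<beta> *\<^sub>R p) \<le> f y - curv_decrease * \<bar>neg_part (lambda_min B)\<bar> ^ 3"
proof -
  define \<nu> where "\<nu> = \<bar>neg_part (lambda_min B)\<bar>"
  have "0 \<le> \<nu>" by (simp add: \<nu>_def)
  have norm_p: "norm p = \<delta> * \<nu>"
    using cond_a_direction(1)[OF a] by (simp add: \<nu>_def)
  have "\<beta> * \<delta> * LH \<le> \<gamma> - \<gamma>H"
    using \<beta>_le \<delta>_pos LH_pos by (simp add: field_simps)
  then have "(\<beta> * \<delta> * LH) * (\<beta>\<^sup>2 * \<delta>\<^sup>2 * \<nu> ^ 3) \<le> (\<gamma> - \<gamma>H) * (\<beta>\<^sup>2 * \<delta>\<^sup>2 * \<nu> ^ 3)"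
    using \<open>0 \<le> \<nu>\<close> by (intro mult_right_mono) auto
  then have cubic: "LH * norm (\<beta> *\<^sub>R p) ^ 3 \<le> (\<gamma> - \<gamma>H) * (\<beta>\<^sup>2 * \<delta>\<^sup>2 * \<nu> ^ 3)"
    using \<beta>_pos by (simp add: norm_p power_mult_distrib power2_eq_square power3_eq_cube algebra_simps)
  have "(\<beta> *\<^sub>R p) \<bullet> (hess y *v (\<beta> *\<^sub>R p)) = \<beta>\<^sup>2 * (p \<bullet> (hess y *v p))"
    by (simp add: matrix_vector_mult_scaleR power2_eq_square)
  also have "\<dots> \<le> \<beta>\<^sup>2 * (- (\<gamma> - \<gamma>H) * \<nu> * (norm p)\<^sup>2)"
    using curvature_along_direction[OF a b] by (intro mult_left_mono) (auto simp: \<nu>_def)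
  also have "\<dots> = - ((\<gamma> - \<gamma>H) * (\<beta>\<^sup>2 * \<delta>\<^sup>2 * \<nu> ^ 3))"
    by (simp add: norm_p power_mult_distrib power2_eq_square power3_eq_cube algebra_simps)
  finally have quadratic: "(\<beta> *\<^sub>R p) \<bullet> (hess y *v (\<beta> *\<^sub>R p)) \<le> - ((\<gamma> - \<gamma>H) * (\<beta>\<^sup>2 * \<delta>\<^sup>2 * \<nu> ^ 3))" .
  have linear: "grad y \<bullet> (\<beta> *\<^sub>R p) \<le> 0"
    using cond_a_direction(2)[OF a] \<beta>_pos by (simp add: mult_nonneg_nonpos)
  have "curv_decrease * \<nu> ^ 3 = (\<gamma> - \<gamma>H) * (\<beta>\<^sup>2 * \<delta>\<^sup>2 * \<nu> ^ 3) / 3"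
    by (simp add: curv_decrease_def)
  with cubic_upper_bound[of y "\<beta> *\<^sub>R p"] cubic quadratic linear show ?thesis
    unfolding \<nu>_def[symmetric] by linarith
qed

lemma curvature_estimates:
  assumes "cond_b \<gamma>H \<gamma>l (hess y) B p"
  shows "\<bar>neg_part (lambda_min (hess y))\<bar> \<le> (1 + \<gamma>l) * \<bar>neg_part (lambda_min B)\<bar>"
    and "\<bar>neg_part (lambda_min B)\<bar> \<le> curv_max"
proof -
  have diff: "\<bar>neg_part (lambda_min B) - neg_part (lambda_min (hess y))\<bar>
      \<le> \<gamma>l * \<bar>neg_part (lambda_min B)\<bar>"
    using assms by (simp add: cond_b_def)
  then show "\<bar>neg_part (lambda_min (hess y))\<bar> \<le> (1 + \<gamma>l) * \<bar>neg_part (lambda_min B)\<bar>"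
    by (simp add: distrib_right)
  have "\<bar>lambda_min (hess y)\<bar> \<le> Lg"
    by (rule abs_eigenvalue_le[OF lambda_min_in_eigenvalues[OF hess_symmetric] norm_hess_le])
  then have "\<bar>neg_part (lambda_min (hess y))\<bar> \<le> Lg"
    using Lg_pos by (auto simp: neg_part_def)
  with diff have "(1 - \<gamma>l) * \<bar>neg_part (lambda_min B)\<bar> \<le> Lg"
    by (simp add: left_diff_distrib)
  then show "\<bar>neg_part (lambda_min B)\<bar> \<le> curv_max"
    using \<gamma>l_less by (simp add: curv_max_def field_simps)
qed

text \<open>
  The crucial estimate. For a direction \<open>p\<close> of length \<open>\<delta> * \<nu>\<close>, where \<open>\<nu> = \<bar>neg_part (lambda_min B)\<bar>\<close>, a Lipschitz
  bound would only give a squared change of order \<open>\<nu>\<^sup>2\<close>, more than the decrease of order \<open>\<nu>\<^sup>3\<close> can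
  pay for. But \<open>p\<close> has negative curvature for the true Hessian, whose spectrum lies above \<open>- 2 * \<nu>\<close>, so
  \<open>norm_nonpos_curvature_image_le\<close> makes the first-order change \<open>hess y *v p\<close> of order \<open>\<nu>\<close> to the power
  3/2; the linearization error is of order \<open>\<nu>\<^sup>2\<close>.
\<close>
lemma gradient_change_along_direction:
  assumes a: "cond_a \<gamma> \<delta> \<theta> (grad y) B g q p" and b: "cond_b \<gamma>H \<gamma>l (hess y) B p"
  shows "(norm (grad (y + \<beta> *\<^sub>R p) - grad y))\<^sup>2 \<le> grad_change * \<bar>neg_part (lambda_min B)\<bar> ^ 3"
proof -
  define \<nu> where "\<nu> = \<bar>neg_part (lambda_min B)\<bar>"
  have \<nu>: "0 \<le> \<nu>" "\<nu> \<le> curv_max"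
    using curvature_estimates(2)[OF b] by (auto simp: \<nu>_def)
  have norm_p: "norm p = \<delta> * \<nu>"
    using cond_a_direction(1)[OF a] by (simp add: \<nu>_def)
  define \<mu> where "\<mu> = 2 * \<nu>"
  have "\<bar>neg_part (lambda_min (hess y))\<bar> \<le> (1 + \<gamma>l) * \<nu>"
    using curvature_estimates(1)[OF b] by (simp add: \<nu>_def)
  also have "\<dots> \<le> 2 * \<nu>"
    using \<gamma>l_less \<nu> by (intro mult_right_mono) auto
  finally have \<mu>: "- \<mu> \<le> lambda_min (hess y)"
    by (auto simp: \<mu>_def neg_part_def split: if_splits)
  have "p \<bullet> (hess y *v p) \<le> - (\<gamma> - \<gamma>H) * \<nu> * (norm p)\<^sup>2"
    using curvature_along_direction[OF a b] by (simp add: \<nu>_def)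
  also have "\<dots> \<le> 0"
    using \<gamma>H_less \<nu> by (intro mult_nonpos_nonneg) auto
  finally have "p \<bullet> (hess y *v p) \<le> 0" .
  then have "(norm (hess y *v p))\<^sup>2 \<le> 2 * (Lg + 2 * \<mu>) * \<mu> * (norm p)\<^sup>2"
    using \<mu> \<nu> by (intro norm_nonpos_curvature_image_le hess_symmetric Lg_pos norm_hess_le)
      (auto simp: \<mu>_def)
  also have "\<dots> = 4 * \<delta>\<^sup>2 * \<nu> ^ 3 * (Lg + 4 * \<nu>)"
    by (simp add: \<mu>_def norm_p power_mult_distrib power2_eq_square power3_eq_cube)
  also have "\<dots> \<le> 4 * \<delta>\<^sup>2 * \<nu> ^ 3 * (Lg + 4 * curv_max)"
    using \<nu> by (intro mult_left_mono) auto
  finally have "\<beta>\<^sup>2 * (norm (hess y *v p))\<^sup>2 \<le> \<beta>\<^sup>2 * (4 * \<delta>\<^sup>2 * \<nu> ^ 3 * (Lg + 4 * curv_max))"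
    by (intro mult_left_mono) auto
  then have hess_part: "(norm (hess y *v (\<beta> *\<^sub>R p)))\<^sup>2 \<le> 4 * \<beta>\<^sup>2 * \<delta>\<^sup>2 * (Lg + 4 * curv_max) * \<nu> ^ 3"
    by (simp add: matrix_vector_mult_scaleR power_mult_distrib algebra_simps)
  define e where "e = grad (y + \<beta> *\<^sub>R p) - grad y - hess y *v (\<beta> *\<^sub>R p)"
  have "norm e \<le> norm (\<beta> *\<^sub>R p) * (LH * norm (\<beta> *\<^sub>R p))"
    unfolding e_def by (rule gradient_linearization) auto
  also have "\<dots> = LH * \<beta>\<^sup>2 * \<delta>\<^sup>2 * \<nu>\<^sup>2"
    using \<beta>_pos by (simp add: norm_p power2_eq_square)
  finally have "(norm e)\<^sup>2 \<le> (LH * \<beta>\<^sup>2 * \<delta>\<^sup>2 * \<nu>\<^sup>2)\<^sup>2"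
    by (intro power_mono) auto
  also have "\<dots> = LH\<^sup>2 * \<beta> ^ 4 * \<delta> ^ 4 * \<nu> ^ 3 * \<nu>"
    by (simp add: power_mult_distrib power2_eq_square power3_eq_cube power4_eq_xxxx)
  also have "\<dots> \<le> LH\<^sup>2 * \<beta> ^ 4 * \<delta> ^ 4 * \<nu> ^ 3 * curv_max"
    using \<nu> by (intro mult_left_mono) auto
  finally have error_part: "(norm e)\<^sup>2 \<le> LH\<^sup>2 * \<beta> ^ 4 * \<delta> ^ 4 * curv_max * \<nu> ^ 3"
    by (simp add: algebra_simps)
  have "(norm (grad (y + \<beta> *\<^sub>R p) - grad y))\<^sup>2 = (norm (e + hess y *v (\<beta> *\<^sub>R p)))\<^sup>2"
    by (simp add: e_def)
  also have "\<dots> \<le> 2 * (norm e)\<^sup>2 + 2 * (norm (hess y *v (\<beta> *\<^sub>R p)))\<^sup>2"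
    by (rule norm_add_squared_le)
  also have "\<dots> \<le> 2 * (LH\<^sup>2 * \<beta> ^ 4 * \<delta> ^ 4 * curv_max * \<nu> ^ 3)
      + 2 * (4 * \<beta>\<^sup>2 * \<delta>\<^sup>2 * (Lg + 4 * curv_max) * \<nu> ^ 3)"
    by (intro add_mono mult_left_mono hess_part error_part) auto
  also have "\<dots> = grad_change * \<nu> ^ 3"
    by (simp add: grad_change_def distrib_right)
  finally show ?thesis by (simp only: \<nu>_def)
qed

definition "grad_const = 2 / grad_decrease + 2 * grad_change / curv_decrease"
definition "curv_const = 8 / curv_decrease"

lemma grad_const_nonneg: "0 \<le> grad_const"
  using grad_decrease_pos curv_decrease_pos grad_change_nonneg by (simp add: grad_const_def)

lemma curv_const_nonneg: "0 \<le> curv_const"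
  using curv_decrease_pos by (simp add: curv_const_def)

text \<open>
  The gradient at \<open>y\<close> is split into the gradient after the step along \<open>p\<close>, charged to the decrease of the
  gradient step, and the change along \<open>p\<close>, charged to the decrease of the curvature step.
\<close>
lemma two_step_progress:
  assumes a: "cond_a \<gamma> \<delta> \<theta> (grad y) B g q p" and b: "cond_b \<gamma>H \<gamma>l (hess y) B p"
    and c: "cond_c \<theta>h (grad (y + \<beta> *\<^sub>R p)) gh"
    and z: "z = y + \<beta> *\<^sub>R p - \<alpha> *\<^sub>R gh"
  shows "(norm (grad y))\<^sup>2 \<le> grad_const * (f y - f z)"
    and "\<bar>neg_part (lambda_min (hess y))\<bar> ^ 3 \<le> curv_const * (f y - f z)"
    and "0 \<le> f y - f z"
proof -
  define \<nu> where "\<nu> = \<bar>neg_part (lambda_min B)\<bar>"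
  have "0 \<le> \<nu>" by (simp add: \<nu>_def)
  have sum: "curv_decrease * \<nu> ^ 3 + grad_decrease * (norm (grad (y + \<beta> *\<^sub>R p)))\<^sup>2 \<le> f y - f z"
    using curvature_step_decrease[OF a b] gradient_step_decrease[OF c] by (simp add: \<nu>_def z)
  have nonneg: "0 \<le> curv_decrease * \<nu> ^ 3" "0 \<le> grad_decrease * (norm (grad (y + \<beta> *\<^sub>R p)))\<^sup>2"
    using curv_decrease_pos grad_decrease_pos \<open>0 \<le> \<nu>\<close> by auto
  show "0 \<le> f y - f z" using sum nonneg by linarith
  have \<nu>3: "\<nu> ^ 3 \<le> (f y - f z) / curv_decrease"
    using sum nonneg curv_decrease_pos by (simp add: field_simps)
  have gh2: "(norm (grad (y + \<beta> *\<^sub>R p)))\<^sup>2 \<le> (f y - f z) / grad_decrease"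
    using sum nonneg grad_decrease_pos by (simp add: field_simps)
  have "(norm (grad y))\<^sup>2 = (norm (grad (y + \<beta> *\<^sub>R p) + (grad y - grad (y + \<beta> *\<^sub>R p))))\<^sup>2"
    by simp
  also have "\<dots> \<le> 2 * (norm (grad (y + \<beta> *\<^sub>R p)))\<^sup>2 + 2 * (norm (grad y - grad (y + \<beta> *\<^sub>R p)))\<^sup>2"
    by (rule norm_add_squared_le)
  also have "\<dots> \<le> 2 * ((f y - f z) / grad_decrease) + 2 * (grad_change * ((f y - f z) / curv_decrease))"
  proof (intro add_mono mult_left_mono gh2)
    have "(norm (grad y - grad (y + \<beta> *\<^sub>R p)))\<^sup>2 \<le> grad_change * \<nu> ^ 3"
      using gradient_change_along_direction[OF a b] by (simp add: \<nu>_def norm_minus_commute)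
    also have "\<dots> \<le> grad_change * ((f y - f z) / curv_decrease)"
      by (intro mult_left_mono \<nu>3 grad_change_nonneg)
    finally show "(norm (grad y - grad (y + \<beta> *\<^sub>R p)))\<^sup>2 \<le> \<dots>" .
  qed auto
  also have "\<dots> = grad_const * (f y - f z)"
    by (simp add: grad_const_def algebra_simps)
  finally show "(norm (grad y))\<^sup>2 \<le> grad_const * (f y - f z)" .
  have "\<bar>neg_part (lambda_min (hess y))\<bar> \<le> (1 + \<gamma>l) * \<nu>"
    using curvature_estimates(1)[OF b] by (simp add: \<nu>_def)
  also have "\<dots> \<le> 2 * \<nu>"
    using \<gamma>l_less \<open>0 \<le> \<nu>\<close> by (intro mult_right_mono) auto
  finally have "\<bar>neg_part (lambda_min (hess y))\<bar> ^ 3 \<le> (2 * \<nu>) ^ 3"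
    by (intro power_mono) auto
  also have "\<dots> = 8 * \<nu> ^ 3" by (simp add: power_mult_distrib)
  also have "\<dots> \<le> 8 * ((f y - f z) / curv_decrease)"
    by (intro mult_left_mono \<nu>3) simp
  finally show "\<bar>neg_part (lambda_min (hess y))\<bar> ^ 3 \<le> curv_const * (f y - f z)"
    by (simp add: curv_const_def)
qed

end

section \<open>Summation along a run\<close>

lemma finite_card_mult_le:
  fixes a :: "nat \<Rightarrow> real"
  assumes "\<And>k. 0 \<le> a k" and sums: "\<And>N. (\<Sum>k<N. a k) \<le> M"
    and "0 < \<eta>" and S: "\<And>k. k \<in> S \<Longrightarrow> \<eta> \<le> a k"
  shows "finite S \<and> real (card S) * \<eta> \<le> M"
proof -
  have le: "real (card T) * \<eta> \<le> M" if "finite T" "T \<subseteq> S" for T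
  proof -
    obtain N where "T \<subseteq> {..<N}"
      using \<open>finite T\<close> finite_nat_iff_bounded by blast
    have "real (card T) * \<eta> \<le> (\<Sum>k\<in>T. a k)"
      using that S by (intro sum_bounded_below) auto
    also have "\<dots> \<le> (\<Sum>k<N. a k)"
      using \<open>T \<subseteq> {..<N}\<close> assms(1) by (intro sum_mono2) auto
    finally show ?thesis using sums order_trans by blast
  qed
  have "finite S"
  proof (rule ccontr)
    assume "infinite S"
    then obtain T where T: "finite T" "card T = Suc (nat \<lceil>M / \<eta>\<rceil>)" "T \<subseteq> S"
      using infinite_arbitrarily_large by blast
    have "M / \<eta> < real (card T)"
      unfolding T(2) by linarith
    with le[OF T(1,3)] \<open>0 < \<eta>\<close> show False
      by (simp add: field_simps)
  qed
  then show ?thesis using le by blast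
qed

lemma first_nonmember:
  fixes S :: "nat set"
  assumes "finite S"
  obtains k where "k \<notin> S" "\<And>j. j < k \<Longrightarrow> j \<in> S" "k \<le> card S"
proof -
  have ex: "\<exists>k. k \<notin> S"
    using assms infinite_UNIV_nat by (metis UNIV_eq_I)
  define k where "k = (LEAST k. k \<notin> S)"
  have "k \<notin> S"
    unfolding k_def using ex by (rule LeastI_ex)
  moreover have below: "j \<in> S" if "j < k" for j
    using that not_less_Least unfolding k_def by blast
  moreover have "k \<le> card S"
    using card_mono[OF assms, of "{..<k}"] below by auto
  ultimately show thesis by (rule that)
qed

lemma reached_Suc: "reached R (Suc k) \<longleftrightarrow> reached R k \<and> \<not> terminates_at R k"
  by (auto simp: reached_def less_Suc_eq)

lemma derivative_evals_le: "derivative_evals R N \<le> 3 * N"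
proof -
  have "derivative_evals R N \<le> (\<Sum>j<N. 3)"
    unfolding derivative_evals_def by (rule sum_mono) simp
  then show ?thesis by simp
qed

context two_step_method
begin

text \<open>
  The entries of a run after termination are arbitrary, so the decrease is set to 0 as soon as no next
  iterate is generated. In the terminating iteration itself the step is zero, so that the value 0 is
  the true decrease there.
\<close>
definition decrease :: "'n run \<Rightarrow> nat \<Rightarrow> real" where
  "decrease R k = (if reached R (Suc k) then f (run.x R k) - f (run.x R (Suc k)) else 0)"

context
  fixes x0 and R :: "'n run"
  assumes run: "two_step_run grad hess \<gamma> \<delta> \<theta> \<gamma>H \<gamma>l \<theta>h \<alpha> \<beta> x0 R"
begin

lemma run_progress:
  assumes "reached R k"
  shows "(norm (grad (run.x R k)))\<^sup>2 \<le> grad_const * decrease R k"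
    and "\<bar>neg_part (lambda_min (hess (run.x R k)))\<bar> ^ 3 \<le> curv_const * decrease R k"
    and "0 \<le> decrease R k"
proof -
  define z where "z = run.x R k + \<beta> *\<^sub>R run.p R k - \<alpha> *\<^sub>R run.gh R k"
  have steps: "cond_a \<gamma> \<delta> \<theta> (grad (run.x R k)) (run.H R k) (run.g R k) (run.q R k) (run.p R k)"
    "cond_b \<gamma>H \<gamma>l (hess (run.x R k)) (run.H R k) (run.p R k)"
    "cond_c \<theta>h (grad (run.x R k + \<beta> *\<^sub>R run.p R k)) (run.gh R k)"
    and d: "run.d R k = - run.gh R k"
    and nxt: "\<not> terminates_at R k \<Longrightarrow> run.x R (Suc k) = z"
    using run assms unfolding two_step_run_def z_def by auto
  have "z = run.x R k" if "terminates_at R k"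
    using that d by (simp add: z_def terminates_at_def)
  then have "decrease R k = f (run.x R k) - f z"
    using nxt assms by (cases "terminates_at R k") (auto simp: decrease_def reached_Suc)
  then show "(norm (grad (run.x R k)))\<^sup>2 \<le> grad_const * decrease R k"
    and "\<bar>neg_part (lambda_min (hess (run.x R k)))\<bar> ^ 3 \<le> curv_const * decrease R k"
    and "0 \<le> decrease R k"
    using two_step_progress[OF steps z_def] by auto
qed

lemma decrease_nonneg: "0 \<le> decrease R k"
  using run_progress(3)[of k] by (cases "reached R k") (auto simp: decrease_def reached_Suc)

lemma sum_decrease_le: "(\<Sum>k<N. decrease R k) \<le> f x0 - fbar"
proof -
  have "(reached R N \<longrightarrow> (\<Sum>k<N. decrease R k) = f x0 - f (run.x R N))
      \<and> (\<Sum>k<N. decrease R k) \<le> f x0 - fbar"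
  proof (induction N)
    case 0
    then show ?case
      using run bounded_below[of x0] by (simp add: two_step_run_def)
  next
    case (Suc N)
    then show ?case
      using bounded_below[of "run.x R (Suc N)"] by (auto simp: decrease_def reached_Suc)
  qed
  then show ?thesis by blast
qed

lemma finite_G_set:
  assumes "0 < \<epsilon>g"
  shows "finite (G_set grad R \<epsilon>g)"
    and "real (card (G_set grad R \<epsilon>g)) \<le> grad_const * (f x0 - fbar) * (1 / \<epsilon>g ^ 2)"
proof -
  have "finite (G_set grad R \<epsilon>g) \<and> real (card (G_set grad R \<epsilon>g)) * \<epsilon>g\<^sup>2 \<le> grad_const * (f x0 - fbar)"
  proof (rule finite_card_mult_le[where a = "\<lambda>k. grad_const * decrease R k"])
    show "\<epsilon>g\<^sup>2 \<le> grad_const * decrease R k" if "k \<in> G_set grad R \<epsilon>g" for k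
    proof -
      have "\<epsilon>g\<^sup>2 \<le> (norm (grad (run.x R k)))\<^sup>2"
        using that assms by (intro power_mono) (auto simp: G_set_def)
      then show ?thesis
        using run_progress(1)[of k] that by (auto simp: G_set_def)
    qed
  qed (use assms sum_decrease_le grad_const_nonneg decrease_nonneg in
      \<open>auto simp: sum_distrib_left[symmetric] intro: mult_left_mono\<close>)
  then show "finite (G_set grad R \<epsilon>g)"
    and "real (card (G_set grad R \<epsilon>g)) \<le> grad_const * (f x0 - fbar) * (1 / \<epsilon>g ^ 2)"
    using assms by (auto simp: field_simps)
qed

lemma finite_H_set:
  assumes "0 < \<epsilon>H"
  shows "finite (H_set hess R \<epsilon>H)"
    and "real (card (H_set hess R \<epsilon>H)) \<le> curv_const * (f x0 - fbar) * (1 / \<epsilon>H ^ 3)"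
proof -
  have "finite (H_set hess R \<epsilon>H) \<and> real (card (H_set hess R \<epsilon>H)) * \<epsilon>H ^ 3 \<le> curv_const * (f x0 - fbar)"
  proof (rule finite_card_mult_le[where a = "\<lambda>k. curv_const * decrease R k"])
    show "\<epsilon>H ^ 3 \<le> curv_const * decrease R k" if "k \<in> H_set hess R \<epsilon>H" for k
    proof -
      have "\<epsilon>H ^ 3 \<le> \<bar>neg_part (lambda_min (hess (run.x R k)))\<bar> ^ 3"
        using that assms by (intro power_mono) (auto simp: H_set_def)
      then show ?thesis
        using run_progress(2)[of k] that by (auto simp: H_set_def)
    qed
  qed (use assms sum_decrease_le curv_const_nonneg decrease_nonneg in
      \<open>auto simp: sum_distrib_left[symmetric] intro: mult_left_mono\<close>)
  then show "finite (H_set hess R \<epsilon>H)"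
    and "real (card (H_set hess R \<epsilon>H)) \<le> curv_const * (f x0 - fbar) * (1 / \<epsilon>H ^ 3)"
    using assms by (auto simp: field_simps)
qed

text \<open>
  A terminating iteration makes no progress, so both optimality measures vanish at its iterate.
\<close>
lemma not_terminates_at_if_bad:
  assumes "0 < \<epsilon>g" "0 < \<epsilon>H" and bad: "k \<in> G_set grad R \<epsilon>g \<union> H_set hess R \<epsilon>H"
  shows "\<not> terminates_at R k"
proof
  assume "terminates_at R k"
  then have zero: "decrease R k = 0" by (simp add: decrease_def reached_Suc)
  have "reached R k" using bad by (auto simp: G_set_def H_set_def)
  from run_progress(1,2)[OF this] zero bad assms show False
    by (auto simp: G_set_def H_set_def)
qed

text \<open>
  All indices before the first one outside both sets are iterations with a violated tolerance, hence
  the method has not terminated there and the first index outside is reached.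
\<close>
lemma first_good_iterate:
  assumes "0 < \<epsilon>g" "0 < \<epsilon>H"
  obtains k where "reached R k" "norm (grad (run.x R k)) \<le> \<epsilon>g" "- \<epsilon>H \<le> lambda_min (hess (run.x R k))"
    "k \<le> card (G_set grad R \<epsilon>g) + card (H_set hess R \<epsilon>H)"
proof -
  have "finite (G_set grad R \<epsilon>g \<union> H_set hess R \<epsilon>H)"
    using finite_G_set finite_H_set assms by blast
  then obtain k where k: "k \<notin> G_set grad R \<epsilon>g \<union> H_set hess R \<epsilon>H"
    "\<And>j. j < k \<Longrightarrow> j \<in> G_set grad R \<epsilon>g \<union> H_set hess R \<epsilon>H"
    "k \<le> card (G_set grad R \<epsilon>g \<union> H_set hess R \<epsilon>H)"
    by (rule first_nonmember) blast
  have "reached R k"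
    using k(2) not_terminates_at_if_bad[OF assms] by (simp add: reached_def)
  moreover from this k(1) have "norm (grad (run.x R k)) \<le> \<epsilon>g"
    and "\<bar>neg_part (lambda_min (hess (run.x R k)))\<bar> \<le> \<epsilon>H"
    by (auto simp: G_set_def H_set_def)
  moreover from this have "- \<epsilon>H \<le> lambda_min (hess (run.x R k))"
    by (auto simp: neg_part_def min_def split: if_splits)
  moreover have "k \<le> card (G_set grad R \<epsilon>g) + card (H_set hess R \<epsilon>H)"
    using k(3) card_Un_le order_trans by blast
  ultimately show thesis using that by blast
qed

end

end

section \<open>The complexity bounds\<close>

theorem corollary2p11:
  fixes f :: "real^'n \<Rightarrow> real"
    and grad :: "real^'n \<Rightarrow> real^'n"
    and hess :: "real^'n \<Rightarrow> real^'n^'n"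
    and x0 :: "real^'n"
    and L\<^sub>g L\<^sub>H fbar \<alpha> \<beta> \<gamma> \<delta> \<theta> \<gamma>\<^sub>H \<gamma>\<^sub>l \<theta>h :: real
  assumes "twice_cont_diff f grad hess"
    and "L\<^sub>g > 0" and "L\<^sub>g-lipschitz_on UNIV grad"
    and "L\<^sub>H > 0" and "\<forall>y z. spectral_norm (hess y - hess z) \<le> L\<^sub>H * dist y z"
    and "\<forall>y. fbar \<le> f y"
    and "0 < \<gamma>" "\<gamma> \<le> 1"
    and "0 < \<delta>"
    and "0 \<le> \<theta>" "\<theta> < 1"
    and "0 \<le> \<gamma>\<^sub>H" "\<gamma>\<^sub>H < \<gamma>"
    and "0 \<le> \<gamma>\<^sub>l" "\<gamma>\<^sub>l < 1"
    and "0 \<le> \<theta>h" "\<theta>h < 1"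
    and "0 < \<alpha>" "\<alpha> \<le> (1 - \<theta>h)\<^sup>2 / (L\<^sub>g * (1 + \<theta>h))"
    and "0 < \<beta>" "\<beta> \<le> (\<gamma> - \<gamma>\<^sub>H) / (\<delta> * L\<^sub>H)"
  shows "\<exists>C::real. \<forall>R. two_step_run grad hess \<gamma> \<delta> \<theta> \<gamma>\<^sub>H \<gamma>\<^sub>l \<theta>h \<alpha> \<beta> x0 R \<longrightarrow>
    (\<forall>\<epsilon>g>0. \<forall>\<epsilon>H>0.
       finite (G_set grad R \<epsilon>g) \<and> real (card (G_set grad R \<epsilon>g)) \<le> C * (1 / \<epsilon>g ^ 2) \<and>
       finite (H_set hess R \<epsilon>H) \<and> real (card (H_set hess R \<epsilon>H)) \<le> C * (1 / \<epsilon>H ^ 3) \<and>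
       (\<exists>k. reached R k \<and>
            norm (grad (run.x R k)) \<le> \<epsilon>g \<and> lambda_min (hess (run.x R k)) \<ge> - \<epsilon>H \<and>
            real k \<le> C * max (1 / \<epsilon>g ^ 2) (1 / \<epsilon>H ^ 3) \<and>
            real (derivative_evals R k) \<le> C * max (1 / \<epsilon>g ^ 2) (1 / \<epsilon>H ^ 3) \<and>
            (\<epsilon>g \<le> 1 \<and> \<epsilon>H \<le> 1 \<longrightarrow>
               real (Suc k) \<le> C * max (1 / \<epsilon>g ^ 2) (1 / \<epsilon>H ^ 3) \<and>
               real (derivative_evals R (Suc k)) \<le> C * max (1 / \<epsilon>g ^ 2) (1 / \<epsilon>H ^ 3))))"
proof -
  interpret two_step_method f grad hess L\<^sub>g L\<^sub>H fbar \<alpha> \<beta> \<gamma> \<delta> \<theta> \<gamma>\<^sub>H \<gamma>\<^sub>l \<theta>h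
  proof unfold_locales
    show "GDERIV f y :> grad y" and "(grad has_derivative (*v) (hess y)) (at y)" for y
      using assms(1) by (auto simp: twice_cont_diff_def)
    show "norm (grad y - grad z) \<le> L\<^sub>g * norm (y - z)" for y z
      using lipschitz_on_normD[OF assms(3)] by simp
    show "norm ((hess y - hess z) *v v) \<le> L\<^sub>H * norm (y - z) * norm v" for y z v
    proof -
      have "norm ((hess y - hess z) *v v) \<le> spectral_norm (hess y - hess z) * norm v"
        unfolding spectral_norm_def by (rule onorm[OF matrix_vector_mul_bounded_linear])
      also have "\<dots> \<le> (L\<^sub>H * dist y z) * norm v"
        using assms(5) by (intro mult_right_mono) auto
      finally show ?thesis by (simp add: dist_norm)
    qed
  qed (use assms in auto)
  define Cg where "Cg = grad_const * (f x0 - fbar)"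
  define Ch where "Ch = curv_const * (f x0 - fbar)"
  have nonneg: "0 \<le> Cg" "0 \<le> Ch"
    using grad_const_nonneg curv_const_nonneg bounded_below[of x0] by (auto simp: Cg_def Ch_def)
  define C where "C = 3 * (Cg + Ch + 1)"
  have C: "Cg \<le> C" "Ch \<le> C" using nonneg by (auto simp: C_def)
  show ?thesis
  proof (rule exI[of _ C], intro allI impI)
    fix R \<epsilon>g \<epsilon>H
    assume run: "two_step_run grad hess \<gamma> \<delta> \<theta> \<gamma>\<^sub>H \<gamma>\<^sub>l \<theta>h \<alpha> \<beta> x0 R"
      and \<epsilon>: "(0::real) < \<epsilon>g" "(0::real) < \<epsilon>H"
    define m where "m = max (1 / \<epsilon>g ^ 2) (1 / \<epsilon>H ^ 3)"
    have m: "0 \<le> m" "1 / \<epsilon>g ^ 2 \<le> m" "1 / \<epsilon>H ^ 3 \<le> m"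
      using \<epsilon> by (auto simp: m_def le_max_iff_disj)
    have m1: "1 \<le> m" if "\<epsilon>g \<le> 1"
    proof -
      have "1 \<le> 1 / \<epsilon>g ^ 2" using that \<epsilon> by (simp add: power_le_one)
      then show ?thesis using m(2) by linarith
    qed
    note G = finite_G_set[OF run \<epsilon>(1), folded Cg_def]
    note H = finite_H_set[OF run \<epsilon>(2), folded Ch_def]
    obtain k where k: "reached R k" "norm (grad (run.x R k)) \<le> \<epsilon>g"
      "- \<epsilon>H \<le> lambda_min (hess (run.x R k))"
      "k \<le> card (G_set grad R \<epsilon>g) + card (H_set hess R \<epsilon>H)"
      by (rule first_good_iterate[OF run \<epsilon>])
    have "real k \<le> Cg * (1 / \<epsilon>g ^ 2) + Ch * (1 / \<epsilon>H ^ 3)"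
      using k(4) G(2) H(2) by linarith
    also have "\<dots> \<le> Cg * m + Ch * m"
      using m nonneg by (intro add_mono mult_left_mono)
    finally have km: "real k \<le> Cg * m + Ch * m" .
    have Cm: "C * m = 3 * (Cg * m + Ch * m) + 3 * m"
      by (simp add: C_def algebra_simps)
    have evals: "real (derivative_evals R N) \<le> 3 * real N" for N
      using derivative_evals_le[of R N] by linarith
    have slack: "3 * real k + 3 * m \<le> C * m"
      unfolding Cm using km by (intro add_right_mono mult_left_mono) auto
    then have "3 * real k \<le> C * m"
      using m(1) by simp
    then have bounds: "real k \<le> C * m" "real (derivative_evals R k) \<le> C * m"
      using evals[of k] by auto
    have bounds1: "real (Suc k) \<le> C * m \<and> real (derivative_evals R (Suc k)) \<le> C * m"
      if "\<epsilon>g \<le> 1"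
      using slack m1[OF that] evals[of "Suc k"] by simp
    have "real (card (G_set grad R \<epsilon>g)) \<le> C * (1 / \<epsilon>g ^ 2)"
      using G(2) mult_right_mono[OF C(1), of "1 / \<epsilon>g ^ 2"] by simp
    moreover have "real (card (H_set hess R \<epsilon>H)) \<le> C * (1 / \<epsilon>H ^ 3)"
      using H(2) mult_right_mono[OF C(2), of "1 / \<epsilon>H ^ 3"] \<epsilon> by simp
    ultimately show "finite (G_set grad R \<epsilon>g) \<and> real (card (G_set grad R \<epsilon>g)) \<le> C * (1 / \<epsilon>g ^ 2) \<and>
       finite (H_set hess R \<epsilon>H) \<and> real (card (H_set hess R \<epsilon>H)) \<le> C * (1 / \<epsilon>H ^ 3) \<and>
       (\<exists>k. reached R k \<and>
            norm (grad (run.x R k)) \<le> \<epsilon>g \<and> lambda_min (hess (run.x R k)) \<ge> - \<epsilon>H \<and>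
            real k \<le> C * max (1 / \<epsilon>g ^ 2) (1 / \<epsilon>H ^ 3) \<and>
            real (derivative_evals R k) \<le> C * max (1 / \<epsilon>g ^ 2) (1 / \<epsilon>H ^ 3) \<and>
            (\<epsilon>g \<le> 1 \<and> \<epsilon>H \<le> 1 \<longrightarrow>
               real (Suc k) \<le> C * max (1 / \<epsilon>g ^ 2) (1 / \<epsilon>H ^ 3) \<and>
               real (derivative_evals R (Suc k)) \<le> C * max (1 / \<epsilon>g ^ 2) (1 / \<epsilon>H ^ 3)))"
      using G(1) H(1) k bounds bounds1 unfolding m_def by blast
  qed
qed

end
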